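(* Let $n\ge 0$ be an integer and $a,b$ real numbers. With the operators $\mathcal L_s,\mathcal L_s^\dagger$ ($1\le s\le 6$) given in the context (for the parameters $n,a,b$), the following identities of polynomials in $x$ hold: $$\begin{aligned} \mathcal L_1P_n^{(a,b)}&=\tfrac12(n+a+b+1)P_{n-1}^{(a+1,b+1)}, & \mathcal L_1^\dagger P_n^{(a,b)}&=2(n+1)P_{n+1}^{(a-1,b-1)},\\ \mathcal L_2P_n^{(a,b)}&=(n+a+b+1)P_n^{(a+1,b)}, & \mathcal L_2^\dagger P_n^{(a,b)}&=2(n+a)P_n^{(a-1,b)},\\ \mathcal L_3P_n^{(a,b)}&=(n+a+b+1)P_n^{(a,b+1)}, & \mathcal L_3^\dagger P_n^{(a,b)}&=2(n+b)P_n^{(a,b-1)},\\ \mathcal L_4P_n^{(a,b)}&=2(n+1)P_{n+1}^{(a-1,b)}, & \mathcal L_4^\dagger P_n^{(a,b)}&=(n+b)P_{n-1}^{(a+1,b)},\\ \mathcal L_5P_n^{(a,b)}&=2(n+1)P_{n+1}^{(a,b-1)}, & \mathcal L_5^\dagger P_n^{(a,b)}&=(n+a)P_{n-1}^{(a,b+1)},\\ \mathcal L_6P_n^{(a,b)}&=(n+b)P_n^{(a+1,b-1)}, & \mathcal L_6^\dagger P_n^{(a,b)}&=(n+a)P_n^{(a-1,b+1)}. \end{aligned}$$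
   Context: Jacobi polynomials: for an integer $m\ge 0$ and real $\alpha,\beta$, $P_m^{(\alpha,\beta)}(x)=\sum_{s=0}^m\binom{m+\alpha}{m-s}\binom{m+\beta}{s}\left(\frac{x-1}{2}\right)^s\left(\frac{x+1}{2}\right)^{m-s}$ (generalized binomial coefficients), and $P_{-1}^{(\alpha,\beta)}=0$. The ladder operators (depending on $n,a,b$) acting on a function $u(x)$, with $u'=du/dx$, are: $\mathcal L_1u=u'$; $\mathcal L_1^\dagger u=((1+x)a-(1-x)b)u-(1-x^2)u'$; $\mathcal L_2u=(a+b+n+1)u+(1+x)u'$; $\mathcal L_2^\dagger u=(2a+(1-x)n)u-(1-x^2)u'$; $\mathcal L_3u=(a+b+n+1)u-(1-x)u'$; $\mathcal L_3^\dagger u=(2b+(1+x)n)u+(1-x^2)u'$; $\mathcal L_4u=((1+x)a-(1-x)(b+n+1))u-(1-x^2)u'$; $\mathcal L_4^\dagger u=-nu+(1+x)u'$; $\mathcal L_5u=((1+x)(a+n+1)-(1-x)b)u-(1-x^2)u'$; $\mathcal L_5^\dagger u=nu+(1-x)u'$; $\mathcal L_6u=bu+(1+x)u'$; $\mathcal L_6^\dagger u=au-(1-x)u'$. *)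

theory Defs
  imports "HOL-Analysis.Analysis"
begin

text \<open>The degree is an integer so that the convention \<open>P\<^sub>-\<^sub>1 = 0\<close> can be expressed; it is
  extended by zero to all negative degrees. The parameters are arbitrary reals, hence the
  generalized binomial coefficients.\<close>

definition jacobi_poly :: "int \<Rightarrow> real \<Rightarrow> real \<Rightarrow> real \<Rightarrow> real" where
  "jacobi_poly m \<alpha> \<beta> x =
     (if m < 0 then 0
      else \<Sum>s = 0..nat m. ((of_int m + \<alpha>) gchoose (nat m - s)) * ((of_int m + \<beta>) gchoose s)
             * ((x - 1) / 2) ^ s * ((x + 1) / 2) ^ (nat m - s))"

text \<open>All twelve ladder operators take the same parameters \<open>n\<close>, \<open>a\<close>, \<open>b\<close>, even where the
  formula does not use all of them. The suffix \<open>d\<close> stands for the dagger.\<close>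

definition L1 :: "nat \<Rightarrow> real \<Rightarrow> real \<Rightarrow> (real \<Rightarrow> real) \<Rightarrow> real \<Rightarrow> real" where
  "L1 n a b u x = deriv u x"

definition L1d :: "nat \<Rightarrow> real \<Rightarrow> real \<Rightarrow> (real \<Rightarrow> real) \<Rightarrow> real \<Rightarrow> real" where
  "L1d n a b u x = ((1 + x) * a - (1 - x) * b) * u x - (1 - x\<^sup>2) * deriv u x"

definition L2 :: "nat \<Rightarrow> real \<Rightarrow> real \<Rightarrow> (real \<Rightarrow> real) \<Rightarrow> real \<Rightarrow> real" where
  "L2 n a b u x = (a + b + real n + 1) * u x + (1 + x) * deriv u x"

definition L2d :: "nat \<Rightarrow> real \<Rightarrow> real \<Rightarrow> (real \<Rightarrow> real) \<Rightarrow> real \<Rightarrow> real" where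
  "L2d n a b u x = (2 * a + (1 - x) * real n) * u x - (1 - x\<^sup>2) * deriv u x"

definition L3 :: "nat \<Rightarrow> real \<Rightarrow> real \<Rightarrow> (real \<Rightarrow> real) \<Rightarrow> real \<Rightarrow> real" where
  "L3 n a b u x = (a + b + real n + 1) * u x - (1 - x) * deriv u x"

definition L3d :: "nat \<Rightarrow> real \<Rightarrow> real \<Rightarrow> (real \<Rightarrow> real) \<Rightarrow> real \<Rightarrow> real" where
  "L3d n a b u x = (2 * b + (1 + x) * real n) * u x + (1 - x\<^sup>2) * deriv u x"

definition L4 :: "nat \<Rightarrow> real \<Rightarrow> real \<Rightarrow> (real \<Rightarrow> real) \<Rightarrow> real \<Rightarrow> real" where
  "L4 n a b u x = ((1 + x) * a - (1 - x) * (b + real n + 1)) * u x - (1 - x\<^sup>2) * deriv u x"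

definition L4d :: "nat \<Rightarrow> real \<Rightarrow> real \<Rightarrow> (real \<Rightarrow> real) \<Rightarrow> real \<Rightarrow> real" where
  "L4d n a b u x = - real n * u x + (1 + x) * deriv u x"

definition L5 :: "nat \<Rightarrow> real \<Rightarrow> real \<Rightarrow> (real \<Rightarrow> real) \<Rightarrow> real \<Rightarrow> real" where
  "L5 n a b u x = ((1 + x) * (a + real n + 1) - (1 - x) * b) * u x - (1 - x\<^sup>2) * deriv u x"

definition L5d :: "nat \<Rightarrow> real \<Rightarrow> real \<Rightarrow> (real \<Rightarrow> real) \<Rightarrow> real \<Rightarrow> real" where
  "L5d n a b u x = real n * u x + (1 - x) * deriv u x"

definition L6 :: "nat \<Rightarrow> real \<Rightarrow> real \<Rightarrow> (real \<Rightarrow> real) \<Rightarrow> real \<Rightarrow> real" where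
  "L6 n a b u x = b * u x + (1 + x) * deriv u x"

definition L6d :: "nat \<Rightarrow> real \<Rightarrow> real \<Rightarrow> (real \<Rightarrow> real) \<Rightarrow> real \<Rightarrow> real" where
  "L6d n a b u x = a * u x - (1 - x) * deriv u x"

end

theory Submission
  imports Defs
begin

text \<open>With \<open>y = (x - 1) / 2\<close> and \<open>z = (x + 1) / 2\<close>, the polynomial \<open>P\<^sub>m\<close> with parameters \<open>a, b\<close> is the
  coefficient of \<open>t\<^sup>m\<close> in \<open>(1 + z t)\<^sup>p (1 + y t)\<^sup>q\<close>, where \<open>p = m + a\<close> and \<open>q = m + b\<close>. Multiplying
  by \<open>1 + z t\<close> or \<open>1 + y t\<close> gives Pascal rules, differentiating in \<open>t\<close> gives an Euler relation,
  and differentiating in \<open>x\<close> expresses the derivative of \<open>P\<^sub>m\<close> by two coefficients of \<open>t\<^sup>m\<^sup>-\<^sup>1\<close>.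
  As \<open>z - y = 1\<close>, the ladder identities are linear consequences of these relations.\<close>

text \<open>Newton's binomial series of \<open>(1 + z t)^p\<close> for an arbitrary real
  exponent.\<close>

definition binomial_fps :: "real \<Rightarrow> real \<Rightarrow> real fps" where
  "binomial_fps p z = Abs_fps (\<lambda>k. (p gchoose k) * z ^ k)"

lemma binomial_fps_nth [simp]: "fps_nth (binomial_fps p z) k = (p gchoose k) * z ^ k"
  by (simp add: binomial_fps_def)

lemma binomial_fps_add1:
  "binomial_fps (p + 1) z = binomial_fps p z + fps_const z * (fps_X * binomial_fps p z)"
proof (rule fps_ext)
  fix k
  show "fps_nth (binomial_fps (p + 1) z) k
      = fps_nth (binomial_fps p z + fps_const z * (fps_X * binomial_fps p z)) k"
    by (cases k) (simp_all add: gbinomial_Suc_Suc ring_distribs mult_ac)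
qed

lemma fps_deriv_binomial_fps:
  "fps_deriv (binomial_fps p z) = fps_const (p * z) * binomial_fps (p - 1) z"
proof (rule fps_ext)
  fix k
  show "fps_nth (fps_deriv (binomial_fps p z)) k
      = fps_nth (fps_const (p * z) * binomial_fps (p - 1) z) k"
    using gbinomial_absorption[of k p] by (simp add: algebra_simps)
qed

text \<open>Chain rule in \<open>x\<close> for \<open>(1 + g x * t)^p\<close>: the inner derivative
  is \<open>d * t\<close>, and its factor \<open>t\<close> becomes \<open>fps_X\<close>.\<close>

lemma DERIV_binomial_fps_nth:
  assumes "(g has_real_derivative d) (at x)"
  shows "((\<lambda>x. fps_nth (binomial_fps p (g x)) k) has_real_derivative
           fps_nth (fps_const (p * d) * (fps_X * binomial_fps (p - 1) (g x))) k) (at x)"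
proof (cases k)
  case (Suc j)
  have "(p gchoose Suc j) * ((1 + real j) * (d * g x ^ j))
      = real (Suc j) * (p gchoose Suc j) * (d * g x ^ j)"
    by (simp add: algebra_simps)
  also have "\<dots> = fps_nth (fps_const (p * d) * (fps_X * binomial_fps (p - 1) (g x))) (Suc j)"
    unfolding gbinomial_absorption by simp
  finally show ?thesis
    using DERIV_cmult[OF DERIV_power_Suc[OF assms, of j], of "p gchoose Suc j"]
    by (simp only: Suc binomial_fps_nth)
qed auto

text \<open>The exponents are decoupled from \<open>m\<close>, so that degree and exponents can be
  shifted separately. Extension by zero to negative \<open>m\<close> keeps the recurrences free of
  side conditions.\<close>

definition binomial_coeff2 :: "int \<Rightarrow> real \<Rightarrow> real \<Rightarrow> real \<Rightarrow> real \<Rightarrow> real" where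
  "binomial_coeff2 m p q y z =
     (if m < 0 then 0 else fps_nth (binomial_fps q y * binomial_fps p z) (nat m))"

lemma jacobi_poly_eq_coeff:
  "jacobi_poly m a b x
     = binomial_coeff2 m (of_int m + a) (of_int m + b) ((x - 1) / 2) ((x + 1) / 2)"
  by (auto simp: jacobi_poly_def binomial_coeff2_def fps_mult_nth intro!: sum.cong)

text \<open>Lowering the index is multiplication by \<open>t\<close>; at \<open>m = 0\<close> both
  sides are zero.\<close>

lemma coeff2_pred:
  "binomial_coeff2 (m - 1) p q y z =
     (if m < 0 then 0 else fps_nth (fps_X * (binomial_fps q y * binomial_fps p z)) (nat m))"
  by (auto simp: binomial_coeff2_def nat_diff_distrib)

lemma coeff2_swap: "binomial_coeff2 m p q y z = binomial_coeff2 m q p z y"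
  by (simp add: binomial_coeff2_def mult.commute)

lemma coeff2_add1_left:
  "binomial_coeff2 m (p + 1) q y z = binomial_coeff2 m p q y z + z * binomial_coeff2 (m - 1) p q y z"
proof -
  have "binomial_fps q y * binomial_fps (p + 1) z = binomial_fps q y * binomial_fps p z
      + fps_const z * (fps_X * (binomial_fps q y * binomial_fps p z))"
    by (simp only: binomial_fps_add1) (simp add: algebra_simps)
  then show ?thesis
    unfolding coeff2_pred by (simp add: binomial_coeff2_def del: fps_X_mult_nth)
qed

lemma coeff2_add1_right:
  "binomial_coeff2 m p (q + 1) y z = binomial_coeff2 m p q y z + y * binomial_coeff2 (m - 1) p q y z"
  using coeff2_add1_left[of m q p z y] by (simp add: coeff2_swap[of _ _ _ z y])

lemma coeff2_euler:
  "of_int m * binomial_coeff2 m p q y z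
     = p * z * binomial_coeff2 (m - 1) (p - 1) q y z + q * y * binomial_coeff2 (m - 1) p (q - 1) y z"
proof (cases "m \<le> 0")
  \<comment> \<open>At \<open>m = 0\<close> the factor \<open>of_int m\<close> vanishes, for
    \<open>m < 0\<close> the coefficient does; on the right only negative indices occur.\<close>
  case True
  then show ?thesis by (cases "m = 0") (auto simp: binomial_coeff2_def)
next
  case False
  define k where "k = nat (m - 1)"
  have m: "m = int (Suc k)" and k: "nat m = Suc k" using False by (auto simp: k_def)
  have "fps_deriv (binomial_fps q y * binomial_fps p z)
      = fps_const (p * z) * (binomial_fps q y * binomial_fps (p - 1) z)
      + fps_const (q * y) * (binomial_fps (q - 1) y * binomial_fps p z)"
    by (simp only: fps_deriv_mult fps_deriv_binomial_fps mult_ac add_ac)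
  from arg_cong[OF this, of "\<lambda>f. fps_nth f k"] show ?thesis
    using False by (simp add: binomial_coeff2_def k del: fps_deriv_mult flip: k_def) (simp add: m)
qed

lemma DERIV_coeff2:
  assumes f: "(f has_real_derivative d) (at x)" and g: "(g has_real_derivative e) (at x)"
  shows "((\<lambda>x. binomial_coeff2 m p q (f x) (g x)) has_real_derivative
           q * d * binomial_coeff2 (m - 1) p (q - 1) (f x) (g x)
         + p * e * binomial_coeff2 (m - 1) (p - 1) q (f x) (g x)) (at x)"
proof (cases "m < 0")
  case True
  then show ?thesis by (simp add: binomial_coeff2_def)
next
  case False
  define F' where "F' = fps_const (q * d) * (fps_X * binomial_fps (q - 1) (f x))"
  define G' where "G' = fps_const (p * e) * (fps_X * binomial_fps (p - 1) (g x))"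
  \<comment> \<open>Each coefficient in \<open>t\<close> is a finite Cauchy sum, so the product rule
    applies termwise.\<close>
  have "((\<lambda>x. fps_nth (binomial_fps q (f x) * binomial_fps p (g x)) n) has_real_derivative
      fps_nth (F' * binomial_fps p (g x) + binomial_fps q (f x) * G') n) (at x)" for n
    unfolding fps_mult_nth fps_add_nth sum.distrib[symmetric]
    by (intro DERIV_sum)
      (use DERIV_mult'[OF DERIV_binomial_fps_nth[OF f] DERIV_binomial_fps_nth[OF g]]
        in \<open>simp only: F'_def G'_def add.commute\<close>)
  moreover have "F' * binomial_fps p (g x) + binomial_fps q (f x) * G'
      = fps_const (q * d) * (fps_X * (binomial_fps (q - 1) (f x) * binomial_fps p (g x)))
      + fps_const (p * e) * (fps_X * (binomial_fps q (f x) * binomial_fps (p - 1) (g x)))"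
    by (simp only: F'_def G'_def mult_ac)
  ultimately show ?thesis
    using False unfolding coeff2_pred
    by (simp add: binomial_coeff2_def del: fps_X_mult_nth)
qed

theorem lemma1:
  fixes n :: nat and a b x :: real
  shows
    "L1 n a b (jacobi_poly (int n) a b) x
       = 1 / 2 * (real n + a + b + 1) * jacobi_poly (int n - 1) (a + 1) (b + 1) x \<and>
     L1d n a b (jacobi_poly (int n) a b) x
       = 2 * (real n + 1) * jacobi_poly (int n + 1) (a - 1) (b - 1) x \<and>
     L2 n a b (jacobi_poly (int n) a b) x
       = (real n + a + b + 1) * jacobi_poly (int n) (a + 1) b x \<and>
     L2d n a b (jacobi_poly (int n) a b) x
       = 2 * (real n + a) * jacobi_poly (int n) (a - 1) b x \<and>
     L3 n a b (jacobi_poly (int n) a b) x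
       = (real n + a + b + 1) * jacobi_poly (int n) a (b + 1) x \<and>
     L3d n a b (jacobi_poly (int n) a b) x
       = 2 * (real n + b) * jacobi_poly (int n) a (b - 1) x \<and>
     L4 n a b (jacobi_poly (int n) a b) x
       = 2 * (real n + 1) * jacobi_poly (int n + 1) (a - 1) b x \<and>
     L4d n a b (jacobi_poly (int n) a b) x
       = (real n + b) * jacobi_poly (int n - 1) (a + 1) b x \<and>
     L5 n a b (jacobi_poly (int n) a b) x
       = 2 * (real n + 1) * jacobi_poly (int n + 1) a (b - 1) x \<and>
     L5d n a b (jacobi_poly (int n) a b) x
       = (real n + a) * jacobi_poly (int n - 1) a (b + 1) x \<and>
     L6 n a b (jacobi_poly (int n) a b) x
       = (real n + b) * jacobi_poly (int n) (a + 1) (b - 1) x \<and>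
     L6d n a b (jacobi_poly (int n) a b) x
       = (real n + a) * jacobi_poly (int n) (a - 1) (b + 1) x"
proof -
  define y where "y = (x - 1) / 2"
  define z where "z = (x + 1) / 2"
  define p where "p = real n + a"
  define q where "q = real n + b"
  define J where "J = (\<lambda>m p q. binomial_coeff2 m p q y z)"
  \<comment> \<open>These equations reduce everything to \<open>y\<close>, \<open>p\<close>,
    \<open>q\<close> and \<open>n\<close>, leaving polynomial identities.\<close>
  have x: "x = 2 * y + 1" and z: "z = y + 1" and a: "a = p - real n" and b: "b = q - real n"
    by (simp_all add: y_def z_def p_def q_def field_simps)
  have P: "jacobi_poly m c d x = J m (of_int m + c) (of_int m + d)" for m c d
    by (simp add: jacobi_poly_eq_coeff J_def y_def z_def)
  have left: "J m r s = J m (r - 1) s + z * J (m - 1) (r - 1) s"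
    and right: "J m r s = J m r (s - 1) + y * J (m - 1) r (s - 1)"
    and euler: "of_int m * J m r s = r * z * J (m - 1) (r - 1) s + s * y * J (m - 1) r (s - 1)"
    for m r s
    using coeff2_add1_left[of m "r - 1" s y z] coeff2_add1_right[of m r "s - 1" y z]
      coeff2_euler[of m r s y z] by (simp_all add: J_def)
  define N where "N = real n"
  \<comment> \<open>These coefficients suffice to express all polynomials in the statement and the
    derivative: raising the degree while lowering a parameter by one leaves the matching exponent
    fixed.\<close>
  define C where "C = J (int n) p q"
  define U where "U = J (int n - 1) p (q - 1)"
  define V where "V = J (int n - 1) (p - 1) q"
  define W where "W = J (int n - 1) p q"
  define K where "K = J (int n + 1) p q"
  define Cp where "Cp = J (int n) (p - 1) q"
  define Cq where "Cq = J (int n) p (q - 1)"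
  note defs = N_def C_def U_def V_def W_def K_def Cp_def Cq_def
  have D: "deriv (jacobi_poly (int n) a b) x = (q * U + p * V) / 2"
  proof (rule DERIV_imp_deriv)
    have "((\<lambda>x. (x - 1) / 2) has_real_derivative 1 / 2) (at x)"
      "((\<lambda>x. (x + 1) / 2) has_real_derivative 1 / 2) (at x)"
      by (auto intro!: derivative_eq_intros)
    from DERIV_coeff2[OF this, of "int n" p q]
    moreover have "jacobi_poly (int n) a b
        = (\<lambda>x. binomial_coeff2 (int n) p q ((x - 1) / 2) ((x + 1) / 2))"
      by (simp add: fun_eq_iff jacobi_poly_eq_coeff p_def q_def)
    ultimately show "(jacobi_poly (int n) a b has_real_derivative (q * U + p * V) / 2) (at x)"
      by (simp add: U_def V_def J_def y_def z_def add_divide_distrib)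
  qed
  have C: "C = Cp + z * V" "C = Cq + y * U"
    using left[of "int n" p q] right[of "int n" p q] by (simp_all add: defs)
  have E: "N * C = p * z * V + q * y * U"
    using euler[of "int n" p q] by (simp add: defs)
  have K: "(N + 1) * K = p * z * Cp + q * y * Cq"
    using euler[of "int n + 1" p q] by (simp add: defs)
  \<comment> \<open>Add \<open>p\<close> times the first Pascal rule to \<open>q\<close> times the
    second; the Euler relation in degree \<open>n - 1\<close> removes both coefficients of degree
    \<open>n - 2\<close>. The factor \<open>p + q - N + 1\<close> is
    \<open>n + a + b + 1\<close>.\<close>
  have W: "p * V + q * U = (p + q - N + 1) * W"
  proof -
    have "W = V + z * J (int n - 2) (p - 1) q" "W = U + y * J (int n - 2) p (q - 1)"
      "(N - 1) * W = p * z * J (int n - 2) (p - 1) q + q * y * J (int n - 2) p (q - 1)"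
      using left[of "int n - 1" p q] right[of "int n - 1" p q] euler[of "int n - 1" p q]
      by (simp_all add: defs)
    then show ?thesis by algebra
  qed
  \<comment> \<open>Where an exponent exceeds \<open>p\<close> or \<open>q\<close> by one, a single
    Pascal step brings it back.\<close>
  have eqs: "jacobi_poly (int n) a b x = C"
    "jacobi_poly (int n - 1) (a + 1) (b + 1) x = W"
    "jacobi_poly (int n + 1) (a - 1) (b - 1) x = K"
    "jacobi_poly (int n) (a + 1) b x = C + z * W"
    "jacobi_poly (int n) (a - 1) b x = Cp"
    "jacobi_poly (int n) a (b + 1) x = C + y * W"
    "jacobi_poly (int n) a (b - 1) x = Cq"
    "jacobi_poly (int n + 1) (a - 1) b x = K + y * C"
    "jacobi_poly (int n - 1) (a + 1) b x = U"
    "jacobi_poly (int n + 1) a (b - 1) x = K + z * C"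
    "jacobi_poly (int n - 1) a (b + 1) x = V"
    "jacobi_poly (int n) (a + 1) (b - 1) x = Cq + z * U"
    "jacobi_poly (int n) (a - 1) (b + 1) x = Cp + y * V"
    using left[of "int n" "p + 1" q] right[of "int n" p "q + 1"]
      left[of "int n + 1" "p + 1" q] right[of "int n + 1" p "q + 1"]
      left[of "int n" "p + 1" "q - 1"] right[of "int n" "p - 1" "q + 1"]
    by (simp_all add: P defs p_def q_def algebra_simps)
  show ?thesis
    unfolding L1_def L1d_def L2_def L2d_def L3_def L3d_def L4_def L4d_def L5_def L5d_def
      L6_def L6d_def eqs D
    \<comment> \<open>For example, in \<open>L4d\<close> the derivative term is
      \<open>z * (q * U + p * V)\<close>; subtracting \<open>E\<close> leaves
      \<open>q * (z - y) * U = q * U\<close>.\<close>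
    unfolding a b x N_def[symmetric]
    using C E K W unfolding z
    by (intro conjI; algebra)
qed

end
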